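(* A function $\varphi$ belongs to $\mathrm{BMO}$ if and only if $\varphi\in\mathrm{BMO}_{2s}$ and $$A_0(\varphi)=\sup_{n\in\mathbb{Z}}\frac1{2^{n+1}}\Big|\int_{[-2^n,0]}\varphi(y)\,dy-\int_{[0,2^n]}\varphi(y)\,dy\Big|<\infty.$$ Moreover, $\|\varphi\|_*\sim\max(\|\varphi\|_{*,2s},A_0(\varphi))$, i.e. there is an absolute constant $c>0$ such that $c^{-1}\max(\|\varphi\|_{*,2s},A_0(\varphi))\le\|\varphi\|_*\le c\,\max(\|\varphi\|_{*,2s},A_0(\varphi))$.
   Context: All functions are on $\mathbb{R}$. For locally integrable $\varphi$ and a bounded interval $I$ let $\varphi_I=\frac1{|I|}\int_I\varphi$. $\mathrm{BMO}$ is the space of locally integrable $\varphi$ with $\|\varphi\|_*=\sup_I\frac1{|I|}\int_I|\varphi(x)-\varphi_I|\,dx<\infty$, the supremum being over all bounded intervals. $\mathrm{BMO}_{2s}$ (two-sided BMO) is defined in the same way with the supremum, denoted $\|\varphi\|_{*,2s}$, restricted to bounded intervals lying on one side of the origin, i.e. contained in $(-\infty,0]$ or in $[0,\infty)$. *)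

theory Defs
  imports "HOL-Analysis.Analysis"
begin

text \<open>
  Functions are defined on the real line and are scalar valued. The sort
  \<open>{real_normed_field, banach, second_countable_topology}\<close> covers both the real and the
  complex case (by Gelfand-Mazur there are no others), and provides the Bochner integral.
  Suprema are taken in \<^typ>\<open>ennreal\<close>, so they are always defined and may be infinite.
\<close>

definition locally_integrable ::
  "(real \<Rightarrow> 'a::{real_normed_field, banach, second_countable_topology}) \<Rightarrow> bool" where
  "locally_integrable \<phi> \<longleftrightarrow> (\<forall>K. compact K \<longrightarrow> set_integrable lebesgue K \<phi>)"

text \<open>Intervals may be open, closed or half-open. Intervals of length zero are excluded, since
  averages over them are undefined.\<close>

definition bounded_intervals :: "real set set" where
  "bounded_intervals = {I. is_interval I \<and> bounded I \<and> measure lebesgue I > 0}"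

definition one_sided_intervals :: "real set set" where
  "one_sided_intervals = {I \<in> bounded_intervals. I \<subseteq> {..0} \<or> I \<subseteq> {0..}}"

definition avg ::
  "(real \<Rightarrow> 'a::{real_normed_field, banach, second_countable_topology}) \<Rightarrow> real set \<Rightarrow> 'a" where
  "avg \<phi> I = (1 / measure lebesgue I) *\<^sub>R (LINT x:I|lebesgue. \<phi> x)"

definition mean_oscillation ::
  "(real \<Rightarrow> 'a::{real_normed_field, banach, second_countable_topology}) \<Rightarrow> real set \<Rightarrow> real" where
  "mean_oscillation \<phi> I =
     (1 / measure lebesgue I) * (LINT x:I|lebesgue. norm (\<phi> x - avg \<phi> I))"

text \<open>The three quantities below are meaningful for locally integrable \<open>\<phi>\<close> only: the Bochner
  integral of a non-integrable function is 0 by convention.\<close>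

definition bmo_norm ::
  "(real \<Rightarrow> 'a::{real_normed_field, banach, second_countable_topology}) \<Rightarrow> ennreal" where
  "bmo_norm \<phi> = (SUP I\<in>bounded_intervals. ennreal (mean_oscillation \<phi> I))"

definition bmo2s_norm ::
  "(real \<Rightarrow> 'a::{real_normed_field, banach, second_countable_topology}) \<Rightarrow> ennreal" where
  "bmo2s_norm \<phi> = (SUP I\<in>one_sided_intervals. ennreal (mean_oscillation \<phi> I))"

definition A0 ::
  "(real \<Rightarrow> 'a::{real_normed_field, banach, second_countable_topology}) \<Rightarrow> ennreal" where
  "A0 \<phi> = (SUP n::int. ennreal
     (1 / 2 powi (n + 1) *
       norm ((LINT y:{- (2 powi n)..0}|lebesgue. \<phi> y) - (LINT y:{0..2 powi n}|lebesgue. \<phi> y))))"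

definition BMO ::
  "(real \<Rightarrow> 'a::{real_normed_field, banach, second_countable_topology}) set" where
  "BMO = {\<phi>. locally_integrable \<phi> \<and> bmo_norm \<phi> < \<infinity>}"

definition BMO2s ::
  "(real \<Rightarrow> 'a::{real_normed_field, banach, second_countable_topology}) set" where
  "BMO2s = {\<phi>. locally_integrable \<phi> \<and> bmo2s_norm \<phi> < \<infinity>}"

end

theory Submission
  imports Defs
begin

text \<open>
  Everything rests on the fact that, in a mean oscillation, the average may be replaced by an
  arbitrary constant at the cost of a factor 2 (\<open>mean_oscillation_le_constant\<close>).

  Write \<open>J = [-2\<^sup>n, 0]\<close> and \<open>K = [0, 2\<^sup>n]\<close>. The two-sided seminorm is a supremum over fewer
  intervals than the BMO seminorm, and the \<open>n\<close>-th term of \<open>A\<^sub>0\<close> does not change when a constant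
  is subtracted from \<open>\<phi>\<close>; subtracting the average over \<open>J \<union> K\<close> bounds it by the mean oscillation
  over \<open>J \<union> K\<close> (\<open>A0_le_bmo_norm\<close>). So the maximum of the two is at most the BMO seminorm.

  Conversely let \<open>M\<close> bound both quantities, and let \<open>I\<close> be an interval that meets both open
  half-lines. For a suitable \<open>n\<close> it lies in \<open>J \<union> K\<close> and has length at least \<open>2\<^sup>n / 2\<close>. With the
  average \<open>c\<close> over \<open>J\<close> as constant, the integral of \<open>|\<phi> - c|\<close> over \<open>J\<close> is at most \<open>2\<^sup>n M\<close>.
  Over \<open>K\<close> it is at most \<open>3 \<cdot> 2\<^sup>n M\<close>, since \<open>A\<^sub>0\<close> controls the difference between the averages
  over \<open>J\<close> and \<open>K\<close>. Comparing \<open>I\<close> with \<open>J \<union> K\<close> gives a mean oscillation of at most \<open>16 M\<close> over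
  \<open>I\<close> (\<open>mean_oscillation_le_straddling\<close>), which is the constant in the theorem.
\<close>

section \<open>Oscillation about an arbitrary constant\<close>

lemma bounded_interval_lmeasurable:
  assumes "I \<in> bounded_intervals"
  shows "I \<in> lmeasurable"
  using assms unfolding bounded_intervals_def
  by (auto intro: measurable_convex simp: is_interval_convex)

lemma set_integrable_bounded_interval:
  assumes "locally_integrable \<phi>" "I \<in> bounded_intervals"
  shows "set_integrable lebesgue I \<phi>"
proof -
  have "compact (closure I)"
    using assms(2) by (simp add: bounded_intervals_def compact_closure)
  then have "set_integrable lebesgue (closure I) \<phi>"
    using assms(1) by (simp add: locally_integrable_def)
  then show ?thesis
    using bounded_interval_lmeasurable[OF assms(2)]
    by (meson closure_subset fmeasurableD set_integrable_subset)
qed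

lemma set_integral_const_lmeasurable:
  fixes c :: "'a::{banach, second_countable_topology}"
  assumes "S \<in> lmeasurable"
  shows "set_integrable lebesgue S (\<lambda>x. c)"
    and "(LINT x:S|lebesgue. c) = measure lebesgue S *\<^sub>R c"
proof -
  have ind: "integrable lebesgue (indicat_real S)"
    using fmeasurableD[OF assms] fmeasurableD2[OF assms]
    by (intro integrable_real_indicator) (simp_all add: top.not_eq_extremum)
  show "set_integrable lebesgue S (\<lambda>x. c)"
    unfolding set_integrable_def by (intro integrable_scaleR_left ind)
  have "(LINT x|lebesgue. indicat_real S x *\<^sub>R c) = (LINT x|lebesgue. indicat_real S x) *\<^sub>R c"
    by (intro integral_scaleR_left ind)
  then show "(LINT x:S|lebesgue. c) = measure lebesgue S *\<^sub>R c"
    by (simp add: set_lebesgue_integral_def)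
qed

lemma set_integral_mono_set:
  fixes g :: "real \<Rightarrow> real"
  assumes "set_integrable lebesgue T g" "S \<in> sets lebesgue" "S \<subseteq> T" "\<And>x. 0 \<le> g x"
  shows "(LINT x:S|lebesgue. g x) \<le> (LINT x:T|lebesgue. g x)"
proof -
  have "set_integrable lebesgue S g"
    using assms(1-3) by (rule set_integrable_subset)
  then show ?thesis
    using assms unfolding set_lebesgue_integral_def set_integrable_def
    by (intro integral_mono) (auto simp: indicator_def)
qed

lemma set_integrable_norm_diff_const:
  fixes \<phi> :: "real \<Rightarrow> 'a::{real_normed_field, banach, second_countable_topology}"
  assumes "S \<in> lmeasurable" "set_integrable lebesgue S \<phi>"
  shows "set_integrable lebesgue S (\<lambda>x. norm (\<phi> x - c))"
proof -
  have "set_integrable lebesgue S (\<lambda>x. c)"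
    by (rule set_integral_const_lmeasurable(1)[OF assms(1)])
  then show ?thesis
    by (intro set_integrable_norm set_integral_diff(1)[OF assms(2)])
qed

lemma norm_set_integral_minus_const_le:
  fixes \<phi> :: "real \<Rightarrow> 'a::{real_normed_field, banach, second_countable_topology}"
  assumes "S \<in> lmeasurable" "set_integrable lebesgue S \<phi>"
  shows "norm ((LINT x:S|lebesgue. \<phi> x) - measure lebesgue S *\<^sub>R c)
           \<le> (LINT x:S|lebesgue. norm (\<phi> x - c))"
proof -
  have c: "set_integrable lebesgue S (\<lambda>x. c)"
    by (rule set_integral_const_lmeasurable(1)[OF assms(1)])
  have "(LINT x:S|lebesgue. \<phi> x - c)
          = (LINT x:S|lebesgue. \<phi> x) - measure lebesgue S *\<^sub>R c"
    by (simp only: set_integral_diff(2)[OF assms(2) c] set_integral_const_lmeasurable(2)[OF assms(1)])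
  moreover have "norm (LINT x:S|lebesgue. \<phi> x - c) \<le> (LINT x:S|lebesgue. norm (\<phi> x - c))"
    by (intro set_integral_norm_bound set_integral_diff(1) assms(2) c)
  ultimately show ?thesis by simp
qed

lemma set_integral_norm_diff_const_le:
  fixes \<phi> :: "real \<Rightarrow> 'a::{real_normed_field, banach, second_countable_topology}"
  assumes "S \<in> lmeasurable" "set_integrable lebesgue S \<phi>"
  shows "(LINT x:S|lebesgue. norm (\<phi> x - c))
           \<le> (LINT x:S|lebesgue. norm (\<phi> x - d)) + measure lebesgue S * norm (d - c)"
proof -
  have const: "set_integrable lebesgue S (\<lambda>x. norm (d - c))"
    by (rule set_integral_const_lmeasurable(1)[OF assms(1)])
  have d: "set_integrable lebesgue S (\<lambda>x. norm (\<phi> x - d))"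
    by (rule set_integrable_norm_diff_const[OF assms])
  have "norm (\<phi> x - c) \<le> norm (\<phi> x - d) + norm (d - c)" for x
    by (metis diff_add_cancel add_diff_eq norm_triangle_ineq)
  then have "(LINT x:S|lebesgue. norm (\<phi> x - c))
          \<le> (LINT x:S|lebesgue. norm (\<phi> x - d) + norm (d - c))"
    by (intro set_integral_mono set_integrable_norm_diff_const[OF assms] set_integral_add(1) d const)
  also have "\<dots> = (LINT x:S|lebesgue. norm (\<phi> x - d)) + measure lebesgue S * norm (d - c)"
    using set_integral_const_lmeasurable(2)[OF assms(1), of "norm (d - c)"]
    by (simp add: set_integral_add(2)[OF d const])
  finally show ?thesis .
qed

lemma mean_oscillation_times_measure:
  assumes "measure lebesgue S > 0"
  shows "(LINT x:S|lebesgue. norm (\<phi> x - avg \<phi> S))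
           = measure lebesgue S * mean_oscillation \<phi> S"
  using assms by (simp add: mean_oscillation_def)

lemma mean_oscillation_le_constant:
  fixes \<phi> :: "real \<Rightarrow> 'a::{real_normed_field, banach, second_countable_topology}"
  assumes S: "S \<in> lmeasurable" and int: "set_integrable lebesgue S \<phi>"
    and pos: "measure lebesgue S > 0"
  shows "measure lebesgue S * mean_oscillation \<phi> S
           \<le> 2 * (LINT x:S|lebesgue. norm (\<phi> x - c))"
proof -
  let ?m = "measure lebesgue S"
  have "?m * norm (c - avg \<phi> S) = norm (?m *\<^sub>R (avg \<phi> S - c))"
    using pos by (simp add: norm_minus_commute)
  also have "?m *\<^sub>R (avg \<phi> S - c) = (LINT x:S|lebesgue. \<phi> x) - ?m *\<^sub>R c"
    using pos by (simp add: avg_def scaleR_diff_right)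
  also have "norm \<dots> \<le> (LINT x:S|lebesgue. norm (\<phi> x - c))"
    by (rule norm_set_integral_minus_const_le[OF S int])
  finally show ?thesis
    using set_integral_norm_diff_const_le[OF S int, of "avg \<phi> S" c]
    by (simp add: mean_oscillation_times_measure[OF pos])
qed

section \<open>Symmetric intervals and their halves\<close>

lemma bounded_intervals_atLeastAtMost:
  "a < b \<Longrightarrow> {a..b} \<in> bounded_intervals"
  by (simp add: bounded_intervals_def is_interval_cc)

lemma set_integral_split_at_zero:
  fixes g :: "real \<Rightarrow> 'b::{banach, second_countable_topology}"
  assumes "set_integrable lebesgue {-r..0} g" "set_integrable lebesgue {0..r} g" "r > 0"
  shows "(LINT x:{-r..r}|lebesgue. g x)
           = (LINT x:{-r..0}|lebesgue. g x) + (LINT x:{0..r}|lebesgue. g x)"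
proof -
  have "AE x in lebesgue. x \<noteq> (0::real)"
    by (intro AE_completion AE_lborel_singleton)
  then have "AE x in lebesgue. \<not> (x \<in> {-r..0} \<and> x \<in> {0..r})"
    by eventually_elim auto
  moreover have "{-r..r} = {-r..0} \<union> {0..r}"
    using assms(3) by auto
  ultimately show ?thesis
    using assms(1,2) by (simp add: set_integral_Un_AE)
qed

text \<open>The two halves have equal length, so subtracting a constant from \<open>\<phi>\<close> leaves the difference
  of the two integrals unchanged. With the average over \<open>[-r, r]\<close> as that constant, the two
  integrals are bounded by the two parts of the integral that defines the mean oscillation.\<close>

lemma half_difference_le_mean_oscillation:
  fixes \<phi> :: "real \<Rightarrow> 'a::{real_normed_field, banach, second_countable_topology}"
  assumes loc: "locally_integrable \<phi>" and r: "r > 0"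
  shows "norm ((LINT y:{-r..0}|lebesgue. \<phi> y) - (LINT y:{0..r}|lebesgue. \<phi> y))
           \<le> 2 * r * mean_oscillation \<phi> {-r..r}"
proof -
  define c where "c = avg \<phi> {-r..r}"
  have J: "{-r..0} \<in> bounded_intervals" and K: "{0..r} \<in> bounded_intervals"
    using r by (auto intro: bounded_intervals_atLeastAtMost)
  note Jm = bounded_interval_lmeasurable[OF J] and Ji = set_integrable_bounded_interval[OF loc J]
  note Km = bounded_interval_lmeasurable[OF K] and Ki = set_integrable_bounded_interval[OF loc K]
  have "norm ((LINT y:{-r..0}|lebesgue. \<phi> y) - (LINT y:{0..r}|lebesgue. \<phi> y))
      = norm (((LINT y:{-r..0}|lebesgue. \<phi> y) - r *\<^sub>R c) - ((LINT y:{0..r}|lebesgue. \<phi> y) - r *\<^sub>R c))"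
    by simp
  also have "\<dots> \<le> norm ((LINT y:{-r..0}|lebesgue. \<phi> y) - r *\<^sub>R c)
      + norm ((LINT y:{0..r}|lebesgue. \<phi> y) - r *\<^sub>R c)"
    by (rule norm_triangle_ineq4)
  also have "\<dots> \<le> (LINT x:{-r..0}|lebesgue. norm (\<phi> x - c)) + (LINT x:{0..r}|lebesgue. norm (\<phi> x - c))"
    using norm_set_integral_minus_const_le[OF Jm Ji, of c]
      norm_set_integral_minus_const_le[OF Km Ki, of c] r by simp
  also have "\<dots> = (LINT x:{-r..r}|lebesgue. norm (\<phi> x - c))"
    by (intro set_integral_split_at_zero[symmetric] set_integrable_norm_diff_const Jm Ji Km Ki r)
  also have "\<dots> = 2 * r * mean_oscillation \<phi> {-r..r}"
    unfolding c_def by (subst mean_oscillation_times_measure) (use r in auto)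
  finally show ?thesis .
qed

lemma oscillation_about_left_average_le:
  fixes \<phi> :: "real \<Rightarrow> 'a::{real_normed_field, banach, second_countable_topology}"
  assumes loc: "locally_integrable \<phi>" and r: "r > 0"
    and left: "mean_oscillation \<phi> {-r..0} \<le> M"
    and right: "mean_oscillation \<phi> {0..r} \<le> M"
    and diff: "norm ((LINT y:{-r..0}|lebesgue. \<phi> y) - (LINT y:{0..r}|lebesgue. \<phi> y)) \<le> 2 * r * M"
  shows "(LINT x:{-r..r}|lebesgue. norm (\<phi> x - avg \<phi> {-r..0})) \<le> 4 * r * M"
proof -
  define c where "c = avg \<phi> {-r..0}"
  define d where "d = avg \<phi> {0..r}"
  have J: "{-r..0} \<in> bounded_intervals" and K: "{0..r} \<in> bounded_intervals"
    using r by (auto intro: bounded_intervals_atLeastAtMost)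
  note Jm = bounded_interval_lmeasurable[OF J] and Ji = set_integrable_bounded_interval[OF loc J]
  note Km = bounded_interval_lmeasurable[OF K] and Ki = set_integrable_bounded_interval[OF loc K]
  have "(LINT x:{-r..0}|lebesgue. norm (\<phi> x - c)) = r * mean_oscillation \<phi> {-r..0}"
    unfolding c_def by (subst mean_oscillation_times_measure) (use r in auto)
  also have "\<dots> \<le> r * M"
    using left r by simp
  finally have on_J: "(LINT x:{-r..0}|lebesgue. norm (\<phi> x - c)) \<le> r * M" .
  have "(LINT x:{0..r}|lebesgue. norm (\<phi> x - d)) = r * mean_oscillation \<phi> {0..r}"
    unfolding d_def by (subst mean_oscillation_times_measure) (use r in auto)
  also have "\<dots> \<le> r * M"
    using right r by simp
  finally have on_K: "(LINT x:{0..r}|lebesgue. norm (\<phi> x - d)) \<le> r * M" .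
  have "r * norm (d - c) = norm (r *\<^sub>R c - r *\<^sub>R d)"
    using r by (simp flip: scaleR_diff_right add: norm_minus_commute)
  also have "r *\<^sub>R c - r *\<^sub>R d = (LINT y:{-r..0}|lebesgue. \<phi> y) - (LINT y:{0..r}|lebesgue. \<phi> y)"
    using r by (simp add: c_def d_def avg_def)
  finally have cd: "r * norm (d - c) \<le> 2 * r * M"
    using diff by simp
  have "(LINT x:{-r..r}|lebesgue. norm (\<phi> x - c))
      = (LINT x:{-r..0}|lebesgue. norm (\<phi> x - c)) + (LINT x:{0..r}|lebesgue. norm (\<phi> x - c))"
    by (intro set_integral_split_at_zero set_integrable_norm_diff_const Jm Ji Km Ki r)
  also have "\<dots> \<le> r * M + (r * M + 2 * r * M)"
    using set_integral_norm_diff_const_le[OF Km Ki, of c d] r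
    by (intro add_mono[OF on_J] order_trans[OF _ add_mono[OF on_K cd]]) simp
  finally show ?thesis
    by (simp add: c_def ac_simps)
qed

section \<open>Intervals on both sides of the origin\<close>

lemma dyadic_bracket:
  fixes b :: real
  assumes "b > 0"
  obtains n :: int where "b \<le> 2 powi n" "2 powi n \<le> 2 * b"
proof
  let ?k = "\<lceil>log 2 b\<rceil>"
  have "b = 2 powr log 2 b"
    using assms by simp
  also have "\<dots> \<le> 2 powr of_int ?k"
    by (intro powr_mono) auto
  finally show "b \<le> 2 powi ?k"
    by (simp add: powr_real_of_int')
  have "2 powr of_int ?k \<le> 2 powr (log 2 b + 1)"
    by (intro powr_mono) linarith+
  also have "\<dots> = 2 * b"
    using assms by (simp add: powr_add)
  finally show "2 powi ?k \<le> 2 * b"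
    by (simp add: powr_real_of_int')
qed

text \<open>An interval containing \<open>0\<close> is at least as long as the supremum \<open>b\<close> of \<open>|x|\<close> on it,
  and the half-length \<open>2\<^sup>n\<close> of the hull is chosen between \<open>b\<close> and \<open>2 b\<close>.\<close>

lemma dyadic_hull_of_straddling_interval:
  assumes I: "I \<in> bounded_intervals" and two_sided: "\<not> I \<subseteq> {..0}" "\<not> I \<subseteq> {0..}"
  obtains n :: int where "I \<subseteq> {- (2 powi n)..2 powi n}" "2 powi n \<le> 2 * measure lebesgue I"
proof -
  have conv: "is_interval I" and bdd: "bounded I"
    using I by (auto simp: bounded_intervals_def)
  have meas: "I \<in> lmeasurable"
    by (rule bounded_interval_lmeasurable[OF I])
  obtain u v where uv: "u \<in> I" "u < 0" "v \<in> I" "0 < v"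
    using two_sided by (metis atLeast_iff atMost_iff not_le subsetI)
  then have "0 \<in> I"
    using mem_is_interval_1_I[OF conv uv(1,3)] by simp
  define b where "b = (SUP x\<in>I. \<bar>x\<bar>)"
  obtain B where "\<forall>x\<in>I. norm x \<le> B"
    using bdd bounded_iff by blast
  then have bd: "bdd_above ((\<lambda>x. \<bar>x\<bar>) ` I)"
    by (intro bdd_aboveI2[of _ _ B]) simp
  have le_b: "\<bar>x\<bar> \<le> b" if "x \<in> I" for x
    unfolding b_def by (rule cSUP_upper[OF that bd])
  have "b > 0"
    using le_b[OF uv(3)] uv(4) by simp
  \<comment> \<open>As \<open>0 \<in> I\<close>, the segment from \<open>0\<close> to any \<open>x \<in> I\<close> lies in \<open>I\<close>.\<close>
  have "\<bar>x\<bar> \<le> measure lebesgue I" if "x \<in> I" for x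
  proof -
    have "{min 0 x..max 0 x} \<subseteq> I"
    proof
      fix y assume "y \<in> {min 0 x..max 0 x}"
      then show "y \<in> I"
        using mem_is_interval_1_I[OF conv \<open>0 \<in> I\<close> that, of y]
          mem_is_interval_1_I[OF conv that \<open>0 \<in> I\<close>, of y]
        by (cases "0 \<le> x") auto
    qed
    then have "measure lebesgue {min 0 x..max 0 x} \<le> measure lebesgue I"
      by (intro measure_mono_fmeasurable meas) auto
    then show ?thesis
      by (auto simp: min_def max_def split: if_splits)
  qed
  then have b_le: "b \<le> measure lebesgue I"
    unfolding b_def using \<open>0 \<in> I\<close> by (intro cSUP_least) auto
  obtain n :: int where n: "b \<le> 2 powi n" "2 powi n \<le> 2 * b"
    using dyadic_bracket[OF \<open>b > 0\<close>] .
  show thesis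
  proof
    show "I \<subseteq> {- (2 powi n)..2 powi n}"
    proof
      fix x assume "x \<in> I"
      then have "\<bar>x\<bar> \<le> 2 powi n"
        using le_b n(1) by (meson order_trans)
      then show "x \<in> {- (2 powi n)..2 powi n}"
        by (simp add: abs_le_iff)
    qed
    show "2 powi n \<le> 2 * measure lebesgue I"
      using n(2) b_le by linarith
  qed
qed

lemma mean_oscillation_le_straddling:
  fixes \<phi> :: "real \<Rightarrow> 'a::{real_normed_field, banach, second_countable_topology}"
  assumes loc: "locally_integrable \<phi>" and M: "M \<ge> 0"
    and one_sided: "\<And>J. J \<in> one_sided_intervals \<Longrightarrow> mean_oscillation \<phi> J \<le> M"
    and diff: "\<And>n::int. norm ((LINT y:{- (2 powi n)..0}|lebesgue. \<phi> y)
                 - (LINT y:{0..2 powi n}|lebesgue. \<phi> y)) \<le> 2 * 2 powi n * M"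
    and I: "I \<in> bounded_intervals"
  shows "mean_oscillation \<phi> I \<le> 16 * M"
proof (cases "I \<subseteq> {..0} \<or> I \<subseteq> {0..}")
  case True
  then have "mean_oscillation \<phi> I \<le> M"
    using I one_sided by (auto simp: one_sided_intervals_def)
  then show ?thesis
    using M by linarith
next
  case False
  then obtain n :: int
    where sub: "I \<subseteq> {- (2 powi n)..2 powi n}" and len: "2 powi n \<le> 2 * measure lebesgue I"
    using dyadic_hull_of_straddling_interval[OF I] by blast
  define r :: real where "r = 2 powi n"
  define c where "c = avg \<phi> {-r..0}"
  have r: "r > 0"
    by (simp add: r_def)
  have pos: "measure lebesgue I > 0"
    using I by (simp add: bounded_intervals_def)
  have D: "{-r..r} \<in> bounded_intervals"
    using r by (intro bounded_intervals_atLeastAtMost) simp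
  have "{-r..0} \<in> one_sided_intervals" "{0..r} \<in> one_sided_intervals"
    using r by (auto simp: one_sided_intervals_def intro!: bounded_intervals_atLeastAtMost)
  then have osc: "(LINT x:{-r..r}|lebesgue. norm (\<phi> x - c)) \<le> 4 * r * M"
    unfolding c_def using r diff[of n]
    by (intro oscillation_about_left_average_le[OF loc] one_sided) (auto simp: r_def)
  have "measure lebesgue I * mean_oscillation \<phi> I \<le> 2 * (LINT x:I|lebesgue. norm (\<phi> x - c))"
    by (intro mean_oscillation_le_constant bounded_interval_lmeasurable
        set_integrable_bounded_interval loc I pos)
  also have "(LINT x:I|lebesgue. norm (\<phi> x - c)) \<le> (LINT x:{-r..r}|lebesgue. norm (\<phi> x - c))"
    using sub bounded_interval_lmeasurable[OF I]
    by (intro set_integral_mono_set set_integrable_norm_diff_const bounded_interval_lmeasurable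
        set_integrable_bounded_interval loc D) (auto simp: r_def)
  also note osc
  also have "2 * (4 * r * M) \<le> measure lebesgue I * (16 * M)"
    using mult_right_mono[OF len M] by (simp add: r_def ac_simps)
  finally show ?thesis
    using pos by simp
qed

section \<open>Comparison of the seminorms\<close>

lemma bmo2s_norm_le_bmo_norm: "bmo2s_norm \<phi> \<le> bmo_norm \<phi>"
  unfolding bmo2s_norm_def bmo_norm_def
  by (intro SUP_subset_mono) (auto simp: one_sided_intervals_def)

lemma A0_le_bmo_norm:
  fixes \<phi> :: "real \<Rightarrow> 'a::{real_normed_field, banach, second_countable_topology}"
  assumes loc: "locally_integrable \<phi>"
  shows "A0 \<phi> \<le> bmo_norm \<phi>"
  unfolding A0_def bmo_norm_def
proof (intro SUP_mono)
  fix n :: int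
  have "1 / 2 powi (n + 1) *
      norm ((LINT y:{- (2 powi n)..0}|lebesgue. \<phi> y) - (LINT y:{0..2 powi n}|lebesgue. \<phi> y))
      \<le> mean_oscillation \<phi> {- (2 powi n)..2 powi n}"
    using half_difference_le_mean_oscillation[OF loc, of "2 powi n"]
    by (simp add: power_int_add field_simps)
  moreover have "{- (2 powi n)..2 powi n :: real} \<in> bounded_intervals"
    by (intro bounded_intervals_atLeastAtMost) (simp add: minus_less_iff)
  ultimately show "\<exists>I\<in>bounded_intervals. ennreal (1 / 2 powi (n + 1) *
      norm ((LINT y:{- (2 powi n)..0}|lebesgue. \<phi> y) - (LINT y:{0..2 powi n}|lebesgue. \<phi> y)))
      \<le> ennreal (mean_oscillation \<phi> I)"
    by (blast intro: ennreal_leI)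
qed

lemma bmo_norm_le_max:
  fixes \<phi> :: "real \<Rightarrow> 'a::{real_normed_field, banach, second_countable_topology}"
  assumes loc: "locally_integrable \<phi>"
  shows "bmo_norm \<phi> \<le> ennreal 16 * max (bmo2s_norm \<phi>) (A0 \<phi>)"
proof (cases "max (bmo2s_norm \<phi>) (A0 \<phi>)")
  case top
  then show ?thesis
    by (simp add: ennreal_mult_top)
next
  case (real M)
  have "bmo2s_norm \<phi> \<le> ennreal M" and A0: "A0 \<phi> \<le> ennreal M"
    using real(2) by (metis max.cobounded1, metis max.cobounded2)
  then have one_sided: "mean_oscillation \<phi> J \<le> M" if "J \<in> one_sided_intervals" for J
    using that real(1) unfolding bmo2s_norm_def SUP_le_iff by (meson ennreal_le_iff)
  have "norm ((LINT y:{- (2 powi n)..0}|lebesgue. \<phi> y) - (LINT y:{0..2 powi n}|lebesgue. \<phi> y))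
      \<le> 2 * 2 powi n * M" for n :: int
  proof -
    have "1 / 2 powi (n + 1) * norm ((LINT y:{- (2 powi n)..0}|lebesgue. \<phi> y)
        - (LINT y:{0..2 powi n}|lebesgue. \<phi> y)) \<le> M"
      using A0 real(1) unfolding A0_def SUP_le_iff by (meson UNIV_I ennreal_le_iff)
    then show ?thesis
      by (simp add: power_int_add field_simps)
  qed
  then have "mean_oscillation \<phi> I \<le> 16 * M" if "I \<in> bounded_intervals" for I
    using mean_oscillation_le_straddling[OF loc real(1) one_sided _ that] by blast
  then have "bmo_norm \<phi> \<le> ennreal (16 * M)"
    unfolding bmo_norm_def by (intro SUP_least ennreal_leI)
  then show ?thesis
    using real by (simp add: ennreal_mult)
qed

theorem proposition3p3:
  shows "(\<forall>\<phi> :: real \<Rightarrow> 'a::{real_normed_field, banach, second_countable_topology}.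
            \<phi> \<in> BMO \<longleftrightarrow> \<phi> \<in> BMO2s \<and> A0 \<phi> < \<infinity>)
       \<and> (\<exists>c::real. c > 0 \<and>
            (\<forall>\<phi> :: real \<Rightarrow> 'a. locally_integrable \<phi> \<longrightarrow>
               ennreal (1 / c) * max (bmo2s_norm \<phi>) (A0 \<phi>) \<le> bmo_norm \<phi> \<and>
               bmo_norm \<phi> \<le> ennreal c * max (bmo2s_norm \<phi>) (A0 \<phi>)))"
proof (intro conjI allI exI[of _ "16::real"] impI)
  fix \<phi> :: "real \<Rightarrow> 'a"
  show "\<phi> \<in> BMO \<longleftrightarrow> \<phi> \<in> BMO2s \<and> A0 \<phi> < \<infinity>"
  proof
    assume "\<phi> \<in> BMO"
    then show "\<phi> \<in> BMO2s \<and> A0 \<phi> < \<infinity>"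
      using bmo2s_norm_le_bmo_norm[of \<phi>] A0_le_bmo_norm[of \<phi>]
      by (auto simp: BMO_def BMO2s_def)
  next
    assume *: "\<phi> \<in> BMO2s \<and> A0 \<phi> < \<infinity>"
    then have loc: "locally_integrable \<phi>"
      by (simp add: BMO2s_def)
    have "ennreal 16 * max (bmo2s_norm \<phi>) (A0 \<phi>) < \<infinity>"
      using * by (auto simp: BMO2s_def ennreal_mult_less_top)
    then show "\<phi> \<in> BMO"
      using bmo_norm_le_max[OF loc] loc by (auto simp: BMO_def)
  qed
next
  show "(16::real) > 0" by simp
next
  fix \<phi> :: "real \<Rightarrow> 'a"
  assume loc: "locally_integrable \<phi>"
  have "ennreal (1 / 16) * max (bmo2s_norm \<phi>) (A0 \<phi>) \<le> 1 * max (bmo2s_norm \<phi>) (A0 \<phi>)"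
    by (intro mult_right_mono) auto
  also have "\<dots> \<le> bmo_norm \<phi>"
    using bmo2s_norm_le_bmo_norm A0_le_bmo_norm[OF loc] by simp
  finally show "ennreal (1 / 16) * max (bmo2s_norm \<phi>) (A0 \<phi>) \<le> bmo_norm \<phi>" .
  show "bmo_norm \<phi> \<le> ennreal 16 * max (bmo2s_norm \<phi>) (A0 \<phi>)"
    by (rule bmo_norm_le_max[OF loc])
qed

end
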